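(* Let $D$ be a digraph and let $\mathcal C\in\mathrm{rs}(D)$ be a reversal sequence of countable length. Then there is a rearrangement $\mathcal C^*$ of $\mathcal C$ of order type at most $\omega$ such that $\mathcal C^*\in\mathrm{rs}(D)$ and $D^{\mathcal C}=D^{\mathcal C^*}$.
   Context: A digraph is an oriented simple graph: no loops, and for distinct $u,v$ at most one of $uv$, $vu$ is an arc. For a directed cycle $C$, $D^{C}$ is the digraph on $V(D)$ with arc set $(A(D)\setminus A(C))\cup\{vu: uv\in A(C)\}$. Reversal sequences $\mathrm{rs}(D)$ (ordinal-indexed sequences of cycles) and $D^{\mathcal C}$ are defined by transfinite recursion: (1) $\emptyset\in\mathrm{rs}(D)$, $D^\emptyset=D$; (2) if $\mathcal C\in\mathrm{rs}(D)$ and $C^*$ is a directed cycle of $D^{\mathcal C}$ then $\mathcal C^\frown\langle C^*\rangle\in\mathrm{rs}(D)$ and $D^{\mathcal C^\frown\langle C^*\rangle}=(D^{\mathcal C})^{C^*}$; (3) if $\mathcal C_\xi\in\mathrm{rs}(D)$ ($\xi<\zeta$) is an increasing (end-extending) sequence whose union $\mathcal C$ is locally finite (each edge lies in only finitely many cycles of $\mathcal C$), then $\mathcal C\in\mathrm{rs}(D)$ and $uv\in A(D^{\mathcal C})$ iff for some $\nu<\zeta$, $uv\in A(D^{\mathcal C_\xi})$ for all $\nu<\xi<\zeta$. A rearrangement of $\mathcal C$ is a sequence containing exactly the same cycles as $\mathcal C$ with the same multiplicities. *)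

theory Defs
  imports "Graph_Theory.Pair_Digraph" "HOL-Library.Equipollence" "HOL-Library.Countable_Set"
begin

unbundle cardinal_syntax

definition oriented_digraph :: "'v pair_pre_digraph \<Rightarrow> bool" where
  "oriented_digraph D \<longleftrightarrow> pair_wf_digraph D \<and>
     (\<forall>v. (v, v) \<notin> parcs D) \<and>
     (\<forall>u v. u \<noteq> v \<longrightarrow> \<not> ((u, v) \<in> parcs D \<and> (v, u) \<in> parcs D))"

(* The library's cycles are lists of arcs, so rotations of the same list differ;
   a directed cycle is taken here to be the subdigraph formed by such a list. *)
definition directed_cycle :: "'v pair_pre_digraph \<Rightarrow> 'v pair_pre_digraph \<Rightarrow> bool" where
  "directed_cycle D C \<longleftrightarrow>
     (\<exists>p. pre_digraph.cycle (with_proj D) p \<and> C = \<lparr>pverts = fst ` set p, parcs = set p\<rparr>)"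

definition reverse_cycle :: "'v pair_pre_digraph \<Rightarrow> 'v pair_pre_digraph \<Rightarrow> 'v pair_pre_digraph" where
  "reverse_cycle D C =
     \<lparr>pverts = pverts D, parcs = (parcs D - parcs C) \<union> {(v, u). (u, v) \<in> parcs C}\<rparr>"

(* A transfinite sequence: idx is a (reflexive) well-order standing for the ordinal length,
   Field idx its set of positions, and cyc the entry at each position (values of cyc outside
   Field idx are irrelevant). *)
record ('i, 'v) cycle_seq =
  idx :: "'i rel"
  cyc :: "'i \<Rightarrow> 'v pair_pre_digraph"

definition append_cycle ::
  "('i, 'v) cycle_seq \<Rightarrow> 'i \<Rightarrow> 'v pair_pre_digraph \<Rightarrow> ('i, 'v) cycle_seq" where
  "append_cycle \<C> x C =
     \<lparr>idx = idx \<C> \<union> insert x (Field (idx \<C>)) \<times> {x}, cyc = (cyc \<C>)(x := C)\<rparr>"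

definition end_extension :: "('i, 'v) cycle_seq \<Rightarrow> ('i, 'v) cycle_seq \<Rightarrow> bool" where
  "end_extension \<C> \<C>' \<longleftrightarrow> idx \<C> initial_segment_of idx \<C>' \<and>
     (\<forall>i\<in>Field (idx \<C>). cyc \<C>' i = cyc \<C> i)"

(* The positions of the cycles passing through the undirected edge uv. *)
definition passing :: "('i, 'v) cycle_seq \<Rightarrow> 'v \<Rightarrow> 'v \<Rightarrow> 'i set" where
  "passing \<C> u v =
     {i \<in> Field (idx \<C>). (u, v) \<in> parcs (cyc \<C> i) \<or> (v, u) \<in> parcs (cyc \<C> i)}"

definition locally_finite :: "('i, 'v) cycle_seq \<Rightarrow> bool" where
  "locally_finite \<C> \<longleftrightarrow> (\<forall>u v. finite (passing \<C> u v))"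

definition limit_order :: "'i rel \<Rightarrow> bool" where
  "limit_order \<zeta> \<longleftrightarrow> Well_order \<zeta> \<and> Field \<zeta> \<noteq> {} \<and>
     (\<forall>\<nu>\<in>Field \<zeta>. \<exists>\<xi>. (\<nu>, \<xi>) \<in> \<zeta> \<and> \<xi> \<noteq> \<nu>)"

(* reversal D \<C> X: \<C> is a reversal sequence of D, and X is the digraph it produces.
   In the limit rule \<zeta> is a limit ordinal (for other \<zeta> the eventual membership would be
   degenerate). It is no restriction that \<zeta> lives on the index type 'i: a strictly increasing
   family of initial segments is no longer than the union. *)
inductive reversal ::
  "'v pair_pre_digraph \<Rightarrow> ('i, 'v) cycle_seq \<Rightarrow> 'v pair_pre_digraph \<Rightarrow> bool"
  for D :: "'v pair_pre_digraph"
where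
  empty: "idx \<C> = {} \<Longrightarrow> reversal D \<C> D"
| append: "\<lbrakk>reversal D \<C> X; directed_cycle X C; x \<notin> Field (idx \<C>)\<rbrakk>
    \<Longrightarrow> reversal D (append_cycle \<C> x C) (reverse_cycle X C)"
| limit: "\<lbrakk>limit_order (\<zeta> :: 'i rel);
     \<And>\<xi>. \<xi> \<in> Field \<zeta> \<Longrightarrow> reversal D (\<S> \<xi> :: ('i, 'v) cycle_seq) (X \<xi>);
     \<And>\<xi> \<eta>. (\<xi>, \<eta>) \<in> \<zeta> \<Longrightarrow> end_extension (\<S> \<xi>) (\<S> \<eta>);
     idx \<C> = (\<Union>\<xi>\<in>Field \<zeta>. idx (\<S> \<xi>));
     \<And>\<xi> i. \<lbrakk>\<xi> \<in> Field \<zeta>; i \<in> Field (idx (\<S> \<xi>))\<rbrakk> \<Longrightarrow> cyc \<C> i = cyc (\<S> \<xi>) i;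
     locally_finite \<C>\<rbrakk>
    \<Longrightarrow> reversal D \<C>
          \<lparr>pverts = pverts D,
           parcs = {(u, v). \<exists>\<nu>\<in>Field \<zeta>. \<forall>\<xi>. (\<nu>, \<xi>) \<in> \<zeta> \<and> \<xi> \<noteq> \<nu> \<longrightarrow> (u, v) \<in> parcs (X \<xi>)}\<rparr>"

definition rs :: "'v pair_pre_digraph \<Rightarrow> ('i, 'v) cycle_seq set" where
  "rs D = {\<C>. \<exists>X. reversal D \<C> X}"

(* See reversal_unique below. *)
definition reverse_seq :: "'v pair_pre_digraph \<Rightarrow> ('i, 'v) cycle_seq \<Rightarrow> 'v pair_pre_digraph" where
  "reverse_seq D \<C> = (THE X. reversal D \<C> X)"

definition rearrangement :: "('j, 'v) cycle_seq \<Rightarrow> ('i, 'v) cycle_seq \<Rightarrow> bool" where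
  "rearrangement \<C>' \<C> \<longleftrightarrow>
     (\<forall>C. {j \<in> Field (idx \<C>'). cyc \<C>' j = C} \<approx> {i \<in> Field (idx \<C>). cyc \<C> i = C})"

lemma Field_append_cycle [simp]: "Field (idx (append_cycle \<C> x C)) = insert x (Field (idx \<C>))"
  by (auto simp: append_cycle_def Field_def)

lemma subset_Field: "r \<subseteq> Field r \<times> Field r"
  by (auto intro: FieldI1 FieldI2)

lemma reversal_Well_order:
  fixes \<C> :: "('i, 'v) cycle_seq"
  assumes "reversal D \<C> X"
  shows "Well_order (idx \<C>)"
  using assms
proof induction
  case (empty \<C>)
  then show ?case by simp
next
  case (append \<C> X C x)
  let ?r = "idx \<C>" and ?r' = "idx (append_cycle \<C> x C)"
  have r: "Refl ?r" "trans ?r" "antisym ?r" "Total ?r" "wf (?r - Id)"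
    using append.IH by (auto simp: order_on_defs)
  have r': "?r' = ?r \<union> insert x (Field ?r) \<times> {x}"
    by (simp add: append_cycle_def)
  have "Refl ?r'"
    using r(1) by (auto simp: refl_on_def r' Field_def)
  moreover have "trans ?r'"
    using r(2) append.hyps unfolding r' trans_def by (auto simp: Field_def)
  moreover have "antisym ?r'"
    using r(3) append.hyps unfolding r' antisym_def by (auto simp: Field_def)
  moreover have "Total ?r'"
    using r(4) unfolding total_on_def Field_append_cycle unfolding r' by auto
  moreover have "wf (?r' - Id)"
  proof -
    have "wf (Field ?r \<times> {x})"
      proof (rule wfI_min)
      fix y and Q :: "'i set" assume "y \<in> Q"
      then show "\<exists>z\<in>Q. \<forall>w. (w, z) \<in> Field ?r \<times> {x} \<longrightarrow> w \<notin> Q"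
        using append.hyps(3) by (cases "Q \<subseteq> {x}") auto
    qed
    then have "wf ((?r - Id) \<union> Field ?r \<times> {x})"
      using r(5) append.hyps by (intro wf_Un) (auto simp: Field_def)
    moreover have "?r' - Id \<subseteq> (?r - Id) \<union> Field ?r \<times> {x}"
      by (auto simp: r')
    ultimately show ?thesis
      by (rule wf_subset)
  qed
  moreover have "?r' \<subseteq> Field ?r' \<times> Field ?r'"
    by (auto simp: Field_def)
  ultimately show ?case
    by (simp add: order_on_defs)
next
  case (limit \<zeta> \<S> X \<C>)
  let ?R = "(\<lambda>\<xi>. idx (\<S> \<xi>)) ` Field \<zeta>"
  have tot: "(\<xi>, \<eta>) \<in> \<zeta> \<or> (\<eta>, \<xi>) \<in> \<zeta>" if "\<xi> \<in> Field \<zeta>" "\<eta> \<in> Field \<zeta>" for \<xi> \<eta>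
  proof (cases "\<xi> = \<eta>")
    case True
    then show ?thesis
      using that limit.hyps(1) by (simp add: limit_order_def order_on_defs refl_on_def)
  next
    case False
    then show ?thesis
      using that limit.hyps(1) by (simp add: limit_order_def order_on_defs total_on_def)
  qed
  have ch: "?R \<in> Chains init_seg_of"
    unfolding Chains_def
  proof safe
    fix \<xi> \<eta> assume "\<xi> \<in> Field \<zeta>" "\<eta> \<in> Field \<zeta>" "(idx (\<S> \<eta>), idx (\<S> \<xi>)) \<notin> init_seg_of"
    then show "(idx (\<S> \<xi>), idx (\<S> \<eta>)) \<in> init_seg_of"
      using tot[of \<xi> \<eta>] limit.hyps(3)[of \<xi> \<eta>] limit.hyps(3)[of \<eta> \<xi>]
      by (auto simp: end_extension_def)
  qed
  have sub: "chain\<^sub>\<subseteq> ?R"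
    using ch unfolding chain_subset_def Chains_def init_seg_of_def by blast
  have W: "Refl r" "trans r" "antisym r" "Total r" "wf (r - Id)" if "r \<in> ?R" for r
    using that limit.IH unfolding order_on_defs by blast+
  have U: "idx \<C> = \<Union>?R"
    using limit.hyps by simp
  have "Refl (\<Union>?R)"
  proof (rule refl_onI)
    fix i assume "i \<in> Field (\<Union>?R)"
    then obtain r where "r \<in> ?R" "i \<in> Field r" by auto
    then show "(i, i) \<in> \<Union>?R"
      using W(1)[of r] by (blast dest: refl_onD)
  qed
  moreover have "trans (\<Union>?R)"
    using chain_subset_trans_Union[OF sub] W by blast
  moreover have "antisym (\<Union>?R)"
    using chain_subset_antisym_Union[OF sub] W by blast
  moreover have "Total (\<Union>?R)"
    using chain_subset_Total_Union[OF sub] W by blast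
  moreover have "wf (\<Union>?R - Id)"
  proof -
    have "\<Union>?R - Id = \<Union>{r - Id | r. r \<in> ?R}"
      by blast
    moreover have "{r - Id | r. r \<in> ?R} \<in> Chains init_seg_of"
      by (rule Chains_inits_DiffI[OF ch])
    ultimately show ?thesis
      using W(5) by (auto intro!: wf_Union_wf_init_segs)
  qed
  moreover have "\<Union>?R \<subseteq> Field (\<Union>?R) \<times> Field (\<Union>?R)"
    by (rule subset_Field)
  ultimately show ?case
    unfolding U by (simp add: order_on_defs)
qed

lemma directed_cycle_arcs: "directed_cycle D C \<Longrightarrow> parcs C \<subseteq> parcs D"
  by (auto simp: directed_cycle_def pre_digraph.cycle_def pre_digraph.awalk_def)

lemma reversal_parity:
  assumes "oriented_digraph D" "reversal D \<C> X"
  shows "pverts X = pverts D \<and> locally_finite \<C> \<and>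
    (\<forall>u v. (u, v) \<in> parcs X \<longleftrightarrow>
      (if even (card (passing \<C> u v)) then (u, v) \<in> parcs D else (v, u) \<in> parcs D))"
  using assms(2)
proof induction
  case (empty \<C>)
  then show ?case by (simp add: locally_finite_def passing_def)
next
  case (append \<C> X C x)
  have asym: "\<not> ((u, v) \<in> parcs X \<and> (v, u) \<in> parcs X)" for u v
  proof -
    have "passing \<C> u v = passing \<C> v u"
      by (auto simp: passing_def)
    then show ?thesis
      using append.IH assms(1) unfolding oriented_digraph_def by metis
  qed
  have sub: "parcs C \<subseteq> parcs X"
    using append.hyps by (simp add: directed_cycle_arcs)
  have pass: "passing (append_cycle \<C> x C) u v =
      (if (u, v) \<in> parcs C \<or> (v, u) \<in> parcs C then insert x (passing \<C> u v) else passing \<C> u v)"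
    for u v
    using append.hyps(3) unfolding passing_def Field_append_cycle
    by (auto simp: append_cycle_def)
  have fin: "finite (passing \<C> u v)" for u v
    using append.IH by (simp add: locally_finite_def)
  have x: "x \<notin> passing \<C> u v" for u v
    using append.hyps(3) by (simp add: passing_def)
  have arc: "(u, v) \<in> parcs (reverse_cycle X C) \<longleftrightarrow>
      (if (u, v) \<in> parcs C \<or> (v, u) \<in> parcs C then (v, u) \<in> parcs X else (u, v) \<in> parcs X)" for u v
    using sub asym[of u v] by (auto simp: reverse_cycle_def)
  have sym: "passing \<C> u v = passing \<C> v u" for u v
    by (auto simp: passing_def)
  have old: "(u, v) \<in> parcs X \<longleftrightarrow>
      (if even (card (passing \<C> u v)) then (u, v) \<in> parcs D else (v, u) \<in> parcs D)" for u v
    using append.IH by blast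
  have "(u, v) \<in> parcs (reverse_cycle X C) \<longleftrightarrow>
      (if even (card (passing (append_cycle \<C> x C) u v)) then (u, v) \<in> parcs D else (v, u) \<in> parcs D)"
    for u v
    unfolding arc pass old[of u v] old[of v u] sym[of v u] using fin[of u v] x[of u v] by simp
  moreover have "locally_finite (append_cycle \<C> x C)"
    using fin by (simp add: locally_finite_def pass)
  moreover have "pverts (reverse_cycle X C) = pverts D"
    using append.IH by (simp add: reverse_cycle_def)
  ultimately show ?case by blast
next
  case (limit \<zeta> \<S> X \<C>)
  have W: "Well_order \<zeta>" and ne: "Field \<zeta> \<noteq> {}"
    using limit.hyps(1) by (auto simp: limit_order_def)
  have refl: "(\<xi>, \<xi>) \<in> \<zeta>" if "\<xi> \<in> Field \<zeta>" for \<xi>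
    using W that by (auto simp: order_on_defs refl_on_def)
  have tr: "trans \<zeta>"
    using W by (auto simp: order_on_defs)
  have tot: "(\<xi>, \<eta>) \<in> \<zeta> \<or> (\<eta>, \<xi>) \<in> \<zeta>" if "\<xi> \<in> Field \<zeta>" "\<eta> \<in> Field \<zeta>" for \<xi> \<eta>
    using that W refl unfolding order_on_defs total_on_def by metis
  have ext: "Field (idx (\<S> \<xi>)) \<subseteq> Field (idx (\<S> \<eta>))" if "(\<xi>, \<eta>) \<in> \<zeta>" for \<xi> \<eta>
    using limit.hyps(3)[OF that] by (auto simp: end_extension_def init_seg_of_def Field_def)
  have FC: "Field (idx \<C>) = (\<Union>\<xi>\<in>Field \<zeta>. Field (idx (\<S> \<xi>)))"
    by (simp add: limit.hyps(4) image_image)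
  have catch: "\<exists>\<nu>\<in>Field \<zeta>. F \<subseteq> Field (idx (\<S> \<nu>))" if "finite F" "F \<subseteq> Field (idx \<C>)" for F
    using that
  proof (induction F)
    case empty
    then show ?case using ne by auto
  next
    case (insert i F)
    then obtain \<nu> \<mu> where "\<nu> \<in> Field \<zeta>" "F \<subseteq> Field (idx (\<S> \<nu>))" "\<mu> \<in> Field \<zeta>" "i \<in> Field (idx (\<S> \<mu>))"
      by (auto simp: FC)
    then show ?case
      using tot[of \<nu> \<mu>] ext[of \<nu> \<mu>] ext[of \<mu> \<nu>] by blast
  qed
  have "(\<exists>\<nu>\<in>Field \<zeta>. \<forall>\<xi>. (\<nu>, \<xi>) \<in> \<zeta> \<and> \<xi> \<noteq> \<nu> \<longrightarrow> (u, v) \<in> parcs (X \<xi>)) \<longleftrightarrow>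
      (if even (card (passing \<C> u v)) then (u, v) \<in> parcs D else (v, u) \<in> parcs D)"
    (is "?L \<longleftrightarrow> ?P") for u v
  proof -
    have "finite (passing \<C> u v)" "passing \<C> u v \<subseteq> Field (idx \<C>)"
      using limit.hyps by (auto simp: locally_finite_def passing_def)
    then obtain \<mu> where \<mu>: "\<mu> \<in> Field \<zeta>" "passing \<C> u v \<subseteq> Field (idx (\<S> \<mu>))"
      using catch by blast
    have pass: "passing (\<S> \<xi>) u v = passing \<C> u v" if "(\<mu>, \<xi>) \<in> \<zeta>" for \<xi>
    proof -
      have \<xi>: "\<xi> \<in> Field \<zeta>"
        using that by (auto simp: Field_def)
      have eq: "cyc \<C> i = cyc (\<S> \<xi>) i" if "i \<in> Field (idx (\<S> \<xi>))" for i
        using limit.hyps \<xi> that by blast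
      have "Field (idx (\<S> \<xi>)) \<subseteq> Field (idx \<C>)"
        using \<xi> FC by blast
      moreover have "passing \<C> u v \<subseteq> Field (idx (\<S> \<xi>))"
        using \<mu>(2) ext[OF that] by blast
      ultimately have "i \<in> passing (\<S> \<xi>) u v \<longleftrightarrow> i \<in> passing \<C> u v" for i
        by (cases "i \<in> Field (idx (\<S> \<xi>))") (auto simp: passing_def eq)
      then show ?thesis by blast
    qed
    have ev: "(u, v) \<in> parcs (X \<xi>) \<longleftrightarrow> ?P" if "(\<mu>, \<xi>) \<in> \<zeta>" for \<xi>
    proof -
      have "\<xi> \<in> Field \<zeta>"
        using that by (auto simp: Field_def)
      then show ?thesis
        using limit.IH pass[OF that] by auto
    qed
    show ?thesis
    proof
      assume ?L
      then obtain \<nu> where \<nu>: "\<nu> \<in> Field \<zeta>" "\<And>\<xi>. (\<nu>, \<xi>) \<in> \<zeta> \<Longrightarrow> \<xi> \<noteq> \<nu> \<Longrightarrow> (u, v) \<in> parcs (X \<xi>)"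
        by blast
      obtain \<kappa> where \<kappa>: "(\<nu>, \<kappa>) \<in> \<zeta>" "(\<mu>, \<kappa>) \<in> \<zeta>"
        using tot[OF \<nu>(1) \<mu>(1)] refl \<nu>(1) \<mu>(1) by blast
      then obtain \<xi> where \<xi>: "(\<kappa>, \<xi>) \<in> \<zeta>" "\<xi> \<noteq> \<kappa>"
        using limit.hyps(1) by (auto simp: limit_order_def Field_def)
      have "(\<nu>, \<xi>) \<in> \<zeta>" "(\<mu>, \<xi>) \<in> \<zeta>"
        using \<kappa> \<xi>(1) tr by (auto dest: transD)
      moreover have "\<xi> \<noteq> \<nu>"
        using \<kappa>(1) \<xi> W by (auto simp: order_on_defs dest: antisymD)
      ultimately show ?P
        using \<nu>(2) ev by blast
    next
      assume ?P
      then show ?L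
        using ev \<mu>(1) by blast
    qed
  qed
  then show ?case
    using limit.hyps by simp
qed

lemma reversal_unique:
  assumes "oriented_digraph D" "reversal D \<C> X" "reversal D \<C> Y"
  shows "X = Y"
proof -
  have "parcs X = parcs Y"
    using reversal_parity[OF assms(1,2)] reversal_parity[OF assms(1,3)] by auto
  then show ?thesis
    using reversal_parity[OF assms(1,2)] reversal_parity[OF assms(1,3)] by simp
qed

end

theory Submission
  imports Defs "HOL-Library.Nat_Bijection"
begin

text \<open>
  Say that position \<open>i\<close> depends on an earlier position \<open>j\<close> if the two cycles share an edge.
  Cycles are finite and the sequence is locally finite, so every position depends on only finitely
  many others; as dependency is also well-founded, its transitive closure has finite down-sets.
  Hence a countable set of positions can be numbered by naturals so that dependency is respected.
  For each edge of a cycle, the new order has the same cycles through that edge in front of it as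
  the old order. The direction of an edge at any stage is the parity of the number of these
  cycles, so the renumbered sequence is again a reversal sequence with the same outcome.
\<close>

section \<open>Numberings compatible with a well-founded relation\<close>

text \<open>Well-founded induction with finite branching makes every down-set under
  \<open>R\<^sup>*\<close> finite, so it has a binary code. A step of \<open>R\<close> enlarges the
  down-set properly, hence also the code. Acyclicity recovers a point from its down-set, which gives
  injectivity.\<close>

lemma wf_finite_branching_numbering:
  fixes R :: "'a rel"
  assumes wf: "wf R" and fin: "\<And>x. finite {y. (y, x) \<in> R}"
    and R: "R \<subseteq> F \<times> F" and F: "countable F"
  shows "\<exists>g :: 'a \<Rightarrow> nat. inj_on g F \<and> (\<forall>(x, y) \<in> R. g x < g y)"
proof -
  obtain e :: "'a \<Rightarrow> nat" where e: "inj_on e F"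
    using F by (auto simp: countable_def)
  define down where "down x = {y. (y, x) \<in> R\<^sup>*}" for x
  have finite_down: "finite (down x)" for x
    using wf
  proof (induction x rule: wf_induct_rule)
    case (less x)
    have "down x = insert x (\<Union>y\<in>{y. (y, x) \<in> R}. down y)"
      by (auto simp: down_def elim: rtranclE intro: rtrancl_into_rtrancl)
    then show ?case
      using less fin by simp
  qed
  have down_F: "down x \<subseteq> F" if "x \<in> F" for x
    using that R by (auto simp: down_def elim: converse_rtranclE)
  have acyclic: "acyclic R"
    using wf by (rule wf_acyclic)
  \<comment> \<open>Number \<open>x\<close> by the binary code of its down-set.\<close>
  define g where "g x = set_encode (e ` down x)" for x
  have "inj_on g F"
  proof (rule inj_onI)
    fix x y assume xy: "x \<in> F" "y \<in> F" "g x = g y"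
    then have "e ` down x = e ` down y"
      using finite_down by (simp add: g_def set_encode_eq)
    then have "down x = down y"
      using inj_on_image_eq_iff[OF e] down_F xy by blast
    then have "(x, y) \<in> R\<^sup>*" "(y, x) \<in> R\<^sup>*"
      by (auto simp: down_def)
    then show "x = y"
      using acyclic by (meson acyclic_impl_antisym_rtrancl antisymD)
  qed
  moreover have "g x < g y" if "(x, y) \<in> R" for x y
  proof -
    have sub: "down x \<subseteq> down y"
      using that by (auto simp: down_def)
    \<comment> \<open>Otherwise the step from \<open>x\<close> to \<open>y\<close> would close a
      cycle in \<open>R\<close>.\<close>
    have "y \<notin> down x"
      using that acyclic by (auto simp: down_def acyclic_def dest: rtrancl_into_trancl1)
    moreover have "y \<in> F" "y \<in> down y"
      using that R by (auto simp: down_def)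
    \<comment> \<open>Injectivity of \<open>e\<close> on \<open>F\<close> ensures that the binary
      digit \<open>e y\<close> is really new.\<close>
    ultimately have "e y \<in> e ` down y - e ` down x"
      using e down_F[of y] sub by (auto dest: inj_onD)
    then have "sum ((^) 2) (e ` down x) < (sum ((^) 2) (e ` down y) :: nat)"
      using sub finite_down by (intro sum_strict_mono2[where b = "e y"]) auto
    then show ?thesis
      by (simp add: g_def set_encode_def)
  qed
  ultimately show ?thesis by blast
qed

section \<open>Directed cycles and parity stages\<close>

lemma directed_cycle_finite_parcs: "directed_cycle D C \<Longrightarrow> finite (parcs C)"
  by (auto simp: directed_cycle_def)

text \<open>Tails and heads are the projections of a pair in every pair digraph, so
  \<open>cas\<close> and \<open>awalk_verts\<close> do not depend on the digraph. It matters only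
  for membership of the start vertex and of the arcs.\<close>

lemma directed_cycle_mono:
  assumes "directed_cycle X C" "pverts X \<subseteq> pverts Y" "parcs C \<subseteq> parcs Y"
  shows "directed_cycle Y C"
proof -
  have cas: "pre_digraph.cas (with_proj X) u p v = pre_digraph.cas (with_proj Y) u p v" for u p v
    by (induction p arbitrary: u) (simp_all add: pre_digraph.cas.simps)
  have "pre_digraph.awalk_verts (with_proj X) u p = pre_digraph.awalk_verts (with_proj Y) u p" for u p
    by (induction p arbitrary: u) (simp_all add: pre_digraph.awalk_verts.simps)
  then have "pre_digraph.cycle (with_proj Y) p"
    if "pre_digraph.cycle (with_proj X) p" "set p = parcs C" for p
    using assms(2,3) that by (auto simp: pre_digraph.cycle_def pre_digraph.awalk_def cas)
  then show ?thesis
    using assms(1) unfolding directed_cycle_def by fastforce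
qed

text \<open>This is the formula of \<open>reversal_parity\<close> cut down to the positions in
  \<open>I\<close>. It refers to no derivation of \<open>reversal\<close>, so stages of the old and
  the new sequence can be compared by counting alone.\<close>

definition stage :: "'v pair_pre_digraph \<Rightarrow> ('i, 'v) cycle_seq \<Rightarrow> 'i set \<Rightarrow> 'v pair_pre_digraph" where
  "stage D \<C> I = \<lparr>pverts = pverts D, parcs = {(u, v).
     if even (card (passing \<C> u v \<inter> I)) then (u, v) \<in> parcs D else (v, u) \<in> parcs D}\<rparr>"

lemma reversal_eq_stage:
  assumes "oriented_digraph D" "reversal D \<C> X"
  shows "X = stage D \<C> (Field (idx \<C>))"
proof -
  have "passing \<C> u v \<inter> Field (idx \<C>) = passing \<C> u v" for u v
    by (auto simp: passing_def)
  then have "parcs X = parcs (stage D \<C> (Field (idx \<C>)))"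
    using reversal_parity[OF assms] by (auto simp: stage_def)
  then show ?thesis
    using reversal_parity[OF assms] by (simp add: stage_def)
qed

lemma stage_cong:
  assumes "\<And>u v. passing \<C> u v \<inter> I = passing \<C>' u v \<inter> J"
  shows "stage D \<C> I = stage D \<C>' J"
  using assms by (simp add: stage_def)

text \<open>Once a position is present, no later extension changes its predecessors or their cycles.
  Its stage is therefore still the digraph to which its cycle was appended.\<close>

lemma reversal_directed_cycle_stage:
  assumes "oriented_digraph D" "reversal D \<C> X" "i \<in> Field (idx \<C>)"
  shows "directed_cycle (stage D \<C> (underS (idx \<C>) i)) (cyc \<C> i)"
  using assms(2,3)
proof (induction arbitrary: i)
  case (empty \<C>)
  then show ?case by simp
next
  case (append \<C> X C x)
  let ?\<C>' = "append_cycle \<C> x C"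
  have under: "underS (idx ?\<C>') x = Field (idx \<C>)"
    using append.hyps(3) by (auto simp: underS_def append_cycle_def intro: FieldI1)
  have under_old: "underS (idx ?\<C>') i = underS (idx \<C>) i" if "i \<noteq> x"
    using that by (auto simp: underS_def append_cycle_def)
  have old: "passing ?\<C>' u v \<inter> I = passing \<C> u v \<inter> I" if "I \<subseteq> Field (idx \<C>)" for u v I
    using that append.hyps(3) unfolding passing_def Field_append_cycle
    by (auto simp: append_cycle_def)
  show ?case
  proof (cases "i = x")
    case True
    have "stage D ?\<C>' (underS (idx ?\<C>') i) = X"
      unfolding reversal_eq_stage[OF assms(1) append.hyps(1)] True under
      by (intro stage_cong old) simp
    then show ?thesis
      using append.hyps(2) True by (simp add: append_cycle_def)
  next
    case False
    then have "i \<in> Field (idx \<C>)"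
      using append.prems by simp
    moreover have "stage D ?\<C>' (underS (idx ?\<C>') i) = stage D \<C> (underS (idx \<C>) i)"
      unfolding under_old[OF False]
      by (intro stage_cong old) (auto simp: underS_def intro: FieldI1)
    ultimately show ?thesis
      using append.IH[of i] False by (simp add: append_cycle_def)
  qed
next
  case (limit \<zeta> \<S> X \<C>)
  then obtain \<xi> where \<xi>: "\<xi> \<in> Field \<zeta>" "i \<in> Field (idx (\<S> \<xi>))"
    by auto
  have W: "Well_order \<zeta>"
    using limit.hyps(1) by (simp add: limit_order_def)
  \<comment> \<open>No member of the chain adds predecessors of \<open>i\<close> to those in
    \<open>\<S> \<xi>\<close>: of any two members, one is an initial segment of the other.\<close>
  have seg: "(j, i) \<in> idx (\<S> \<xi>)" if ji: "(j, i) \<in> idx (\<S> \<eta>)" and \<eta>: "\<eta> \<in> Field \<zeta>" for j \<eta>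
  proof (cases "(\<eta>, \<xi>) \<in> \<zeta>")
    case True
    then show ?thesis
      using limit.hyps(3)[OF True] ji by (auto simp: end_extension_def init_seg_of_def)
  next
    case False
    then have "(\<xi>, \<eta>) \<in> \<zeta>"
      using W \<xi>(1) \<eta> by (metis well_order_on_Well_order wo_rel.TOTALS wo_rel_def)
    from limit.hyps(3)[OF this] have
      "\<forall>a b c. (a, b) \<in> idx (\<S> \<eta>) \<and> (b, c) \<in> idx (\<S> \<xi>) \<longrightarrow> (a, b) \<in> idx (\<S> \<xi>)"
      by (auto simp: end_extension_def init_seg_of_def)
    \<comment> \<open>Closure under predecessors in \<open>init_seg_of\<close> is triggered by a
      pair \<open>(b, c)\<close> of the smaller relation; for \<open>b = i\<close> the reflexive
      pair serves.\<close>
    moreover have "(i, i) \<in> idx (\<S> \<xi>)"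
      using reversal_Well_order[OF limit.hyps(2)[OF \<xi>(1)]] \<xi>(2)
      by (auto simp: order_on_defs refl_on_def)
    ultimately show ?thesis
      using ji by blast
  qed
  have under: "underS (idx \<C>) i = underS (idx (\<S> \<xi>)) i"
    using seg \<xi>(1) by (auto simp: underS_def limit.hyps(4))
  have "stage D \<C> (underS (idx \<C>) i) = stage D (\<S> \<xi>) (underS (idx (\<S> \<xi>)) i)"
    unfolding under
  proof (rule stage_cong)
    fix u v
    have "j \<in> Field (idx (\<S> \<xi>)) \<and> j \<in> Field (idx \<C>) \<and> cyc \<C> j = cyc (\<S> \<xi>) j"
      if "j \<in> underS (idx (\<S> \<xi>)) i" for j
    proof -
      have "j \<in> Field (idx (\<S> \<xi>))"
        using that by (auto simp: underS_def intro: FieldI1)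
      then show ?thesis
        using limit.hyps(5)[OF \<xi>(1)] \<xi>(1) by (auto simp: limit.hyps(4))
    qed
    then show "passing \<C> u v \<inter> underS (idx (\<S> \<xi>)) i = passing (\<S> \<xi>) u v \<inter> underS (idx (\<S> \<xi>)) i"
      by (auto simp: passing_def)
  qed
  then show ?case
    using limit.IH[OF \<xi>] limit.hyps(5)[OF \<xi>] by simp
qed

section \<open>Sequences indexed by sets of naturals\<close>

lemma Field_Restr_natLeq [simp]: "Field (Restr natLeq A) = A"
  by (auto simp: Field_def natLeq_def)

text \<open>If \<open>natLeq\<close> were strictly shorter, it would be isomorphic to the part of
  \<open>A\<close> strictly below some \<open>a\<close>, which is finite.\<close>

lemma Restr_natLeq_ordLeq: "Restr natLeq A \<le>o natLeq"
proof -
  let ?r = "Restr natLeq A"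
  have W: "Well_order ?r"
    using natLeq_Well_order by (rule Well_order_Restr)
  have "\<not> natLeq <o ?r"
  proof
    assume "natLeq <o ?r"
    then obtain a where a: "natLeq =o Restr ?r (underS ?r a)"
      using ordLess_iff_ordIso_Restr[OF W natLeq_Well_order] by blast
    have "underS ?r a \<subseteq> {..a}"
      by (auto simp: underS_def natLeq_def)
    then have "finite (Field (Restr ?r (underS ?r a)))"
      by (rule finite_subset[rotated, OF finite_subset[OF _ finite_atMost]]) (auto simp: Field_def)
    moreover obtain f where "iso natLeq (Restr ?r (underS ?r a)) f"
      using a by (auto simp: ordIso_def)
    then have "bij_betw f (UNIV :: nat set) (Field (Restr ?r (underS ?r a)))"
      by (simp add: iso_def Field_natLeq)
    ultimately show False
      using bij_betw_finite infinite_UNIV_nat by blast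
  qed
  then show ?thesis
    using not_ordLess_iff_ordLeq W natLeq_Well_order by blast
qed

lemma limit_order_natLeq: "limit_order natLeq"
  unfolding limit_order_def
proof (intro conjI ballI)
  fix n :: nat
  show "\<exists>m. (n, m) \<in> natLeq \<and> m \<noteq> n"
    by (rule exI[of _ "Suc n"]) (simp add: natLeq_def)
qed (use natLeq_Well_order in \<open>auto simp: Field_natLeq\<close>)

text \<open>The prefixes below \<open>n\<close> are built by appending, and the limit rule along
  \<open>natLeq\<close> joins them. Prefixes may repeat, since \<open>end_extension\<close> is
  reflexive; this handles gaps in \<open>A\<close> and finite \<open>A\<close> uniformly.\<close>

lemma nat_cycle_seq_in_rs:
  fixes c :: "nat \<Rightarrow> 'v pair_pre_digraph" and A :: "nat set"
  defines "\<C> \<equiv> \<lparr>idx = Restr natLeq A, cyc = c\<rparr>"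
  assumes D: "oriented_digraph D" and lf: "locally_finite \<C>"
    and cycle: "\<And>n. n \<in> A \<Longrightarrow> directed_cycle (stage D \<C> {..<n}) (c n)"
  shows "\<C> \<in> rs D"
proof -
  define \<S> where "\<S> n = \<lparr>idx = Restr natLeq (A \<inter> {..<n}), cyc = c\<rparr>" for n
  have "\<exists>X. reversal D (\<S> n) X" for n
  proof (induction n)
    case 0
    show ?case
      by (rule exI, rule reversal.empty) (simp add: \<S>_def)
  next
    case (Suc n)
    then obtain X where X: "reversal D (\<S> n) X" by blast
    show ?case
    proof (cases "n \<in> A")
      case True
      have "X = stage D \<C> {..<n}"
        unfolding reversal_eq_stage[OF D X]
        by (rule stage_cong) (auto simp: passing_def \<S>_def \<C>_def)
      then have "directed_cycle X (c n)"
        using cycle True by simp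
      moreover have "n \<notin> Field (idx (\<S> n))"
        by (simp add: \<S>_def)
      moreover have "append_cycle (\<S> n) n (c n) = \<S> (Suc n)"
        using True by (auto simp: append_cycle_def \<S>_def) (auto simp: natLeq_def)
      ultimately show ?thesis
        using reversal.append[OF X] by metis
    next
      case False
      then have "\<S> (Suc n) = \<S> n"
        by (auto simp: \<S>_def less_Suc_eq)
      then show ?thesis using X by auto
    qed
  qed
  then obtain X where X: "\<And>n. reversal D (\<S> n) (X n)" by metis
  have "end_extension (\<S> m) (\<S> n)" if "(m, n) \<in> natLeq" for m n
    using that by (auto simp: end_extension_def init_seg_of_def \<S>_def natLeq_def)
  moreover have "idx \<C> = (\<Union>n\<in>Field natLeq. idx (\<S> n))"
    by (auto simp: \<C>_def \<S>_def Field_natLeq) (auto simp: natLeq_def intro: le_imp_less_Suc lessI)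
  moreover have "cyc \<C> i = cyc (\<S> n) i" for i n
    by (simp add: \<C>_def \<S>_def)
  ultimately show ?thesis
    using reversal.limit[where \<C> = \<C> and \<S> = \<S> and X = X, OF limit_order_natLeq X _ _ _ lf]
    by (auto simp: rs_def)
qed

section \<open>Rearranging a countable reversal sequence\<close>

theorem theorem8p4:
  fixes D :: "'v pair_pre_digraph" and \<C> :: "('i, 'v) cycle_seq"
  assumes "oriented_digraph D"
    and "\<C> \<in> rs D"
    and "countable (Field (idx \<C>))"
  shows "\<exists>\<C>' :: (nat, 'v) cycle_seq.
    rearrangement \<C>' \<C> \<and> idx \<C>' \<le>o natLeq \<and> \<C>' \<in> rs D \<and> reverse_seq D \<C> = reverse_seq D \<C>'"
proof -
  let ?F = "Field (idx \<C>)"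
  obtain X where X: "reversal D \<C> X"
    using assms(2) by (auto simp: rs_def)
  have W: "Well_order (idx \<C>)"
    using X by (rule reversal_Well_order)
  have cycle: "directed_cycle (stage D \<C> (underS (idx \<C>) i)) (cyc \<C> i)" if "i \<in> ?F" for i
    using reversal_directed_cycle_stage[OF assms(1) X that] .
  have fin: "finite (passing \<C> u v)" for u v
    using reversal_parity[OF assms(1) X] by (simp add: locally_finite_def)

  \<comment> \<open>Dependency: an earlier cycle shares an edge with a later one. One orientation
    \<open>(u, v)\<close> suffices because \<open>passing\<close> ignores direction.\<close>
  define R where "R = {(j, i). (j, i) \<in> idx \<C> - Id \<and> (\<exists>(u, v)\<in>parcs (cyc \<C> i). j \<in> passing \<C> u v)}"
  have "wf R"
    using W by (auto simp: order_on_defs R_def intro: wf_subset)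
  moreover have "R \<subseteq> ?F \<times> ?F"
    by (auto simp: R_def intro: FieldI1 FieldI2)
  moreover have "finite {j. (j, i) \<in> R}" for i
  proof (cases "i \<in> ?F")
    case True
    have "{j. (j, i) \<in> R} \<subseteq> (\<Union>(u, v)\<in>parcs (cyc \<C> i). passing \<C> u v)"
      by (auto simp: R_def)
    moreover have "finite (parcs (cyc \<C> i))"
      using directed_cycle_finite_parcs cycle[OF True] by blast
    ultimately show ?thesis
      using fin by (elim finite_subset) auto
  next
    case False
    then have "{j. (j, i) \<in> R} = {}"
      by (auto simp: R_def intro: FieldI2)
    then show ?thesis by simp
  qed
  ultimately obtain g :: "'i \<Rightarrow> nat" where
    inj: "inj_on g ?F" and mono: "\<And>j i. (j, i) \<in> R \<Longrightarrow> g j < g i"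
    using wf_finite_branching_numbering[of R ?F] assms(3) by blast

  \<comment> \<open>The image of \<open>g\<close> may have gaps; the values of \<open>c\<close>
    there lie outside the index field of \<open>\<C>'\<close> and are irrelevant.\<close>
  define c where "c n = cyc \<C> (inv_into ?F g n)" for n
  define \<C>' where "\<C>' = \<lparr>idx = Restr natLeq (g ` ?F), cyc = c\<rparr>"
  have c_g: "c (g i) = cyc \<C> i" if "i \<in> ?F" for i
    using inj that by (simp add: c_def)
  have passing': "passing \<C>' u v = g ` passing \<C> u v" for u v
    using c_g by (auto simp: passing_def \<C>'_def)
  have card': "card (g ` I) = card I" if "I \<subseteq> ?F" for I
    using inj that by (meson card_image inj_on_subset)
  have passing_F: "passing \<C> u v \<subseteq> ?F" for u v
    by (auto simp: passing_def)

  have "locally_finite \<C>'"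
    using fin by (simp add: locally_finite_def passing')
  moreover have "directed_cycle (stage D \<C>' {..<g i}) (c (g i))" if i: "i \<in> ?F" for i
  proof -
    let ?X = "stage D \<C> (underS (idx \<C>) i)"
    \<comment> \<open>The old and new stages may differ away from the cycle; by
      \<open>directed_cycle_mono\<close> only its own arcs must survive.\<close>
    have "(u, v) \<in> parcs (stage D \<C>' {..<g i})" if uv: "(u, v) \<in> parcs (cyc \<C> i)" for u v
    proof -
      \<comment> \<open>Positions whose cycles use the edge \<open>uv\<close> are related to
        \<open>i\<close> by \<open>R\<close> in one direction or the other, so \<open>g\<close>
        keeps their order relative to \<open>i\<close>. The parity for this edge is thus
        unchanged.\<close>
      have iff: "g k < g i \<longleftrightarrow> k \<in> underS (idx \<C>) i" if k: "k \<in> passing \<C> u v" for k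
      proof (cases "k = i")
        case False
        have "k \<in> ?F" using k passing_F by blast
        then consider "(k, i) \<in> idx \<C>" "(i, k) \<notin> idx \<C>" | "(i, k) \<in> idx \<C>" "(k, i) \<notin> idx \<C>"
          using W i False unfolding order_on_defs total_on_def antisym_def by metis
        then show ?thesis
        proof cases
          case 1
          then have "(k, i) \<in> R"
            using False k uv by (auto simp: R_def)
          then show ?thesis
            using mono 1 False by (auto simp: underS_def)
        next
          case 2
          have "(i, k) \<in> R"
            using 2 False k uv i by (auto simp: R_def passing_def)
          then show ?thesis
            using mono[of i k] 2 by (auto simp: underS_def)
        qed
      qed (simp add: underS_def)
      have "passing \<C>' u v \<inter> {..<g i} = g ` (passing \<C> u v \<inter> underS (idx \<C>) i)"
        using iff by (auto simp: passing')
      then have "card (passing \<C>' u v \<inter> {..<g i}) = card (passing \<C> u v \<inter> underS (idx \<C>) i)"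
        using card' passing_F by (metis inf.coboundedI1)
      moreover have "(u, v) \<in> parcs ?X"
        using uv directed_cycle_arcs[OF cycle[OF i]] by blast
      ultimately show ?thesis
        by (simp add: stage_def)
    qed
    then have "parcs (cyc \<C> i) \<subseteq> parcs (stage D \<C>' {..<g i})"
      by auto
    then show ?thesis
      unfolding c_g[OF i] by (rule directed_cycle_mono[OF cycle[OF i], rotated]) (simp add: stage_def)
  qed
  ultimately have rs': "\<C>' \<in> rs D"
    unfolding \<C>'_def by (intro nat_cycle_seq_in_rs[OF assms(1)]) auto
  then obtain Y where Y: "reversal D \<C>' Y"
    by (auto simp: rs_def)
  \<comment> \<open>Renumbering keeps the total count on every edge, and by
    \<open>reversal_parity\<close> these counts determine the final digraph.\<close>
  have "card (passing \<C>' u v) = card (passing \<C> u v)" for u v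
    using card' passing_F by (simp add: passing')
  then have "parcs X = parcs Y"
    using reversal_parity[OF assms(1) X] reversal_parity[OF assms(1) Y] by auto
  then have "X = Y"
    using reversal_parity[OF assms(1) X] reversal_parity[OF assms(1) Y] by simp
  moreover have "reverse_seq D \<C> = X" "reverse_seq D \<C>' = Y"
    using X Y reversal_unique[OF assms(1)] unfolding reverse_seq_def by blast+
  moreover have "rearrangement \<C>' \<C>"
    unfolding rearrangement_def
  proof
    fix C
    have "{j \<in> Field (idx \<C>'). cyc \<C>' j = C} = g ` {i \<in> ?F. cyc \<C> i = C}"
      using c_g by (auto simp: \<C>'_def)
    moreover have "inj_on g {i \<in> ?F. cyc \<C> i = C}"
      using inj by (rule inj_on_subset) auto
    ultimately show "{j \<in> Field (idx \<C>'). cyc \<C>' j = C} \<approx> {i \<in> ?F. cyc \<C> i = C}"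
      by (simp add: inj_on_image_eqpoll_self)
  qed
  moreover have "idx \<C>' \<le>o natLeq"
    by (simp add: \<C>'_def Restr_natLeq_ordLeq)
  ultimately show ?thesis
    using rs' by metis
qed

end
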